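(* Let $G$ be a connected graph of order $n$ and let $n = n_1+n_2+\cdots+n_k$ be a partition of $n$ into positive integers. Then $V(G)$ can be partitioned into $k$ parts $A_1,A_2,\ldots,A_k$ such that, for every $1 \le i \le k$, $|A_i| = n_i$ and there exists a subtree $T_i$ of $G$ of order at most $2n_i-1$ such that $A_i \subseteq V(T_i)$.
   Context: Graphs are finite, and the order of a graph is its number of vertices. A subtree of $G$ is a subgraph of $G$ that is a tree; the subtrees $T_1,\dots,T_k$ are not required to be disjoint. *)

theory Defs
  imports "Graph_Theory.Digraph_Component" "HOL-Library.Disjoint_Sets"
begin

text \<open>
  A finite simple graph is an element of the locale \<^locale>\<open>graph\<close>: a finite digraph without loops
  and parallel arcs whose arc relation is symmetric, each undirected edge being a pair of opposite
  arcs.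

  The library predicate \<^const>\<open>tree\<close> is not suitable for this representation. Its acyclicity
  condition forbids directed cycles, so the pair of opposite arcs of an edge already violates it,
  while a transitively oriented triangle satisfies it. In a symmetric digraph without loops and
  parallel arcs, the cycles of the undirected graph are the directed cycles of length at least 3,
  since \<^const>\<open>pre_digraph.cycle\<close> requires the vertices to be distinct.
\<close>

definition undirected_tree :: "('a, 'b) pre_digraph \<Rightarrow> bool" where
  "undirected_tree T \<longleftrightarrow>
     graph T \<and> Digraph_Component.connected T \<and> \<not> (\<exists>p. pre_digraph.cycle T p \<and> 3 \<le> length p)"

definition subtree :: "('a, 'b) pre_digraph \<Rightarrow> ('a, 'b) pre_digraph \<Rightarrow> bool" where
  "subtree T G \<longleftrightarrow> subgraph T G \<and> undirected_tree T"

end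

theory Submission
  imports Defs
begin

text \<open>
  Present a connected vertex set with root \<open>r\<close> as built from single vertices by joining two disjoint
  rooted sets \<open>X\<close> (root \<open>r\<close>) and \<open>Y\<close> (root \<open>c\<close>) along an edge \<open>r c\<close>; the root of the result is \<open>r\<close>.
  It suffices to carve off a part \<open>A\<close> of size \<open>s\<close>, inside a connected set of size at most \<open>2 s - 1\<close>,
  so that a rooted set remains, and to repeat this with the next size. In \<open>X \<union> Y\<close>, recurse into \<open>Y\<close>
  if \<open>s \<le> |Y|\<close> and into \<open>X\<close> if \<open>s < |X|\<close>. Otherwise \<open>|Y| \<le> s - 1\<close> and \<open>|X| \<le> s\<close>, so \<open>X \<union> Y\<close> itself is
  small enough, and \<open>A\<close> consists of \<open>Y\<close> and of vertices peeled off from \<open>X\<close>.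
\<close>

section \<open>Rooted vertex sets\<close>

inductive rooted :: "('a \<Rightarrow> 'a \<Rightarrow> bool) \<Rightarrow> 'a \<Rightarrow> 'a set \<Rightarrow> bool" for E where
  single: "rooted E r {r}"
| join: "rooted E r X \<Longrightarrow> rooted E c Y \<Longrightarrow> E r c \<Longrightarrow> X \<inter> Y = {} \<Longrightarrow> rooted E r (X \<union> Y)"

lemma rooted_finite: "rooted E r V \<Longrightarrow> finite V"
  by (induction rule: rooted.induct) auto

lemma rooted_root: "rooted E r V \<Longrightarrow> r \<in> V"
  by (induction rule: rooted.induct) auto

text \<open>The new vertex is pushed down to the side of the join that contains \<open>u\<close>,
  until a singleton is reached; since \<open>v\<close> is outside both sides, they stay disjoint.
  This is the growth step in \<open>connected_rooted\<close>.\<close>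

lemma rooted_add_leaf:
  assumes "rooted E r V" "u \<in> V" "E u v" "v \<notin> V"
  shows "rooted E r (insert v V)"
  using assms
proof (induction rule: rooted.induct)
  case (single r)
  have "rooted E r ({r} \<union> {v})"
    using single by (intro rooted.join[of E r "{r}" v] rooted.single) auto
  then show ?case by (simp add: insert_commute)
next
  case (join r X c Y)
  show ?case
  proof (cases "u \<in> X")
    case True
    then have "rooted E r (insert v X \<union> Y)"
      using join by (intro rooted.join) auto
    then show ?thesis by simp
  next
    case False
    then have "rooted E r (X \<union> insert v Y)"
      using join by (intro rooted.join) auto
    then show ?thesis by simp
  qed
qed

text \<open>If \<open>X\<close> already leaves \<open>U\<close>, so does an edge found there.
  Otherwise \<open>Y\<close> leaves \<open>U\<close>: either \<open>c\<close> lies in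
  \<open>U\<close> and the induction hypothesis for \<open>Y\<close> applies, or the joining edge
  \<open>r c\<close> itself leaves \<open>U\<close>. This lets a subtree inside a rooted set
  grow.\<close>

lemma rooted_edge_leaving:
  assumes "rooted E r V" "r \<in> U" "\<not> V \<subseteq> U"
  shows "\<exists>u\<in>U. \<exists>v\<in>V - U. E u v"
  using assms
proof (induction rule: rooted.induct)
  case (join r X c Y)
  show ?case
  proof (cases "X \<subseteq> U")
    case True
    then have "\<not> Y \<subseteq> U" using join by auto
    moreover have "c \<in> Y" using join rooted_root by metis
    ultimately show ?thesis using join by (cases "c \<in> U") blast+
  next
    case False
    then show ?thesis using join by blast
  qed
qed auto

section \<open>Carving parts off a rooted set\<close>

text \<open>Vertices are taken from the branch \<open>Y\<close> first. While some of
  \<open>Y\<close> remains, its root \<open>c\<close> remains as well, so the rest is still joined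
  to \<open>r\<close>; once \<open>Y\<close> is exhausted, peeling continues in \<open>X\<close>.
  The strict bound on \<open>s\<close> lets the root survive.\<close>

lemma rooted_peel:
  assumes "rooted E r V" "s < card V"
  shows "\<exists>A\<subseteq>V. card A = s \<and> rooted E r (V - A)"
  using assms
proof (induction arbitrary: s rule: rooted.induct)
  case (single r)
  then show ?case by (intro exI[of _ "{}"]) (auto intro: rooted.single)
next
  case (join r X c Y)
  have fin: "finite X" "finite Y" using join rooted_finite by metis+
  then have card: "card (X \<union> Y) = card X + card Y" using join by (simp add: card_Un_disjoint)
  show ?case
  proof (cases "s < card Y")
    case True
    then obtain A where A: "A \<subseteq> Y" "card A = s" "rooted E c (Y - A)" using join.IH(2) by blast
    then have "rooted E r (X \<union> (Y - A))" using join by (intro rooted.join) auto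
    moreover have "X \<union> (Y - A) = (X \<union> Y) - A" using A(1) join by blast
    ultimately show ?thesis using A by (intro exI[of _ A]) auto
  next
    case False
    then have "s - card Y < card X" using join.prems card by linarith
    then obtain A where A: "A \<subseteq> X" "card A = s - card Y" "rooted E r (X - A)"
      using join.IH(1) by blast
    have "A \<inter> Y = {}" "finite A" using A(1) join fin finite_subset by blast+
    then have "card (A \<union> Y) = s" using A fin False by (simp add: card_Un_disjoint)
    moreover have "X - A = (X \<union> Y) - (A \<union> Y)" using A(1) join by blast
    ultimately show ?thesis using A by (intro exI[of _ "A \<union> Y"]) auto
  qed
qed

text \<open>The alternative \<open>A = V\<close> is separate because rooted sets are nonempty. The
  root \<open>q\<close> is left free since \<open>B\<close> may lie deep inside a branch.\<close>

lemma rooted_carve: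
  assumes "rooted E r V" "0 < s" "s \<le> card V"
  shows "\<exists>A B q. A \<subseteq> B \<and> B \<subseteq> V \<and> card A = s \<and> card B \<le> 2 * s - 1 \<and> rooted E q B \<and>
    (A = V \<or> rooted E r (V - A))"
  using assms
proof (induction rule: rooted.induct)
  case (single r)
  then show ?case
    by (intro exI[of _ "{r}"] exI[of _ r]) (auto intro: rooted.single)
next
  case (join r X c Y)
  have fin: "finite X" "finite Y" using join rooted_finite by metis+
  then have card: "card (X \<union> Y) = card X + card Y" using join by (simp add: card_Un_disjoint)
  consider "s \<le> card Y" | "s < card X" | "card Y < s" "card X \<le> s" by linarith
  then show ?case
  proof cases
    case 1
    then obtain A B q where A: "A \<subseteq> B" "B \<subseteq> Y" "card A = s" "card B \<le> 2 * s - 1" "rooted E q B"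
      "A = Y \<or> rooted E c (Y - A)" using join.IH(2) join.prems by blast
    have "rooted E r ((X \<union> Y) - A)"
    proof (cases "A = Y")
      case True
      then have "(X \<union> Y) - A = X" using join by blast
      then show ?thesis using join by simp
    next
      case False
      then have "rooted E r (X \<union> (Y - A))" using A join by (intro rooted.join) auto
      moreover have "X \<union> (Y - A) = (X \<union> Y) - A" using A join by blast
      ultimately show ?thesis by simp
    qed
    moreover have "B \<subseteq> X \<union> Y" using A(2) by blast
    ultimately have "A \<subseteq> B \<and> B \<subseteq> X \<union> Y \<and> card A = s \<and> card B \<le> 2 * s - 1 \<and> rooted E q B \<and>
        (A = X \<union> Y \<or> rooted E r ((X \<union> Y) - A))"
      using A(1,3-5) by (intro conjI disjI2)
    then show ?thesis by (intro exI)
  next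
    case 2
    then have "s \<le> card X" by simp
    then obtain A B q where A: "A \<subseteq> B" "B \<subseteq> X" "card A = s" "card B \<le> 2 * s - 1" "rooted E q B"
      "A = X \<or> rooted E r (X - A)" using join.IH(1) join.prems by blast
    \<comment> \<open>Strictness of \<open>s < card X\<close> matters: removing all of
      \<open>X\<close> would leave \<open>Y\<close> without the root \<open>r\<close> it hangs
      from.\<close>
    then have "A \<noteq> X" using 2 by auto
    then have "rooted E r ((X - A) \<union> Y)" using A join by (intro rooted.join) auto
    moreover have "(X - A) \<union> Y = (X \<union> Y) - A" using A join by blast
    ultimately have "rooted E r ((X \<union> Y) - A)" by simp
    moreover have "B \<subseteq> X \<union> Y" using A(2) by blast
    ultimately have "A \<subseteq> B \<and> B \<subseteq> X \<union> Y \<and> card A = s \<and> card B \<le> 2 * s - 1 \<and> rooted E q B \<and>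
        (A = X \<union> Y \<or> rooted E r ((X \<union> Y) - A))"
      using A(1,3-5) by (intro conjI disjI2)
    then show ?thesis by (intro exI)
  next
    case 3
    have XY: "rooted E r (X \<union> Y)" using join by (intro rooted.join)
    have "\<exists>A\<subseteq>X \<union> Y. card A = s \<and> (A = X \<union> Y \<or> rooted E r ((X \<union> Y) - A))"
      using rooted_peel[OF XY, of s] join.prems by (cases "s = card (X \<union> Y)") auto
    then obtain A where A: "A \<subseteq> X \<union> Y" "card A = s" "A = X \<union> Y \<or> rooted E r ((X \<union> Y) - A)"
      by blast
    have "card (X \<union> Y) \<le> 2 * s - 1" using 3 card by linarith
    then have "A \<subseteq> X \<union> Y \<and> X \<union> Y \<subseteq> X \<union> Y \<and> card A = s \<and> card (X \<union> Y) \<le> 2 * s - 1 \<and>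
        rooted E r (X \<union> Y) \<and> (A = X \<union> Y \<or> rooted E r ((X \<union> Y) - A))"
      using A XY by (intro conjI) simp_all
    then show ?thesis by (intro exI)
  qed
qed

text \<open>Induction on the index set with \<open>V\<close> generalized: carve off one part and
  treat what remains, which is empty or again rooted at \<open>r\<close>. Only the parts
  \<open>A i\<close> are kept disjoint; the set \<open>B\<close> of one part may meet parts carved
  later.\<close>

lemma rooted_partition:
  assumes "finite I" "\<And>i. i \<in> I \<Longrightarrow> 0 < m i" "V = {} \<or> rooted E r V" "card V = (\<Sum>i\<in>I. m i)"
  shows "\<exists>A. (\<Union>i\<in>I. A i) = V \<and> disjoint_family_on A I \<and>
    (\<forall>i\<in>I. card (A i) = m i \<and>
      (\<exists>B q. rooted E q B \<and> B \<subseteq> V \<and> card B \<le> 2 * m i - 1 \<and> A i \<subseteq> B))"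
  using assms
proof (induction I arbitrary: V rule: finite_induct)
  case empty
  \<comment> \<open>Cardinality 0 alone would also allow an infinite \<open>V\<close>; finiteness of
    rooted sets excludes this.\<close>
  then have "V = {}" using rooted_finite by fastforce
  then show ?case by (auto simp: disjoint_family_on_def)
next
  case (insert i I)
  have cV: "card V = m i + (\<Sum>i\<in>I. m i)" using insert by simp
  have mi: "0 < m i" using insert by simp
  then have "V \<noteq> {}" using cV by (metis add_is_0 card.empty less_numeral_extra(3))
  then have rV: "rooted E r V" using insert.prems by blast
  then obtain C B q where C: "C \<subseteq> B" "B \<subseteq> V" "card C = m i" "card B \<le> 2 * m i - 1" "rooted E q B"
    "C = V \<or> rooted E r (V - C)" using rooted_carve[OF rV mi] cV by auto
  have CV: "C \<subseteq> V" using C by blast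
  have "card (V - C) = (\<Sum>i\<in>I. m i)"
    using CV rooted_finite[OF rV] C cV by (simp add: card_Diff_subset finite_subset)
  moreover have "V - C = {} \<or> rooted E r (V - C)" using C by blast
  ultimately obtain A where A: "(\<Union>j\<in>I. A j) = V - C" "disjoint_family_on A I"
    "\<forall>j\<in>I. card (A j) = m j \<and>
      (\<exists>B q. rooted E q B \<and> B \<subseteq> V - C \<and> card B \<le> 2 * m j - 1 \<and> A j \<subseteq> B)"
    using insert.IH[of "V - C"] insert.prems(1) by auto
  let ?A = "A(i := C)"
  have eq: "\<And>j. j \<in> I \<Longrightarrow> ?A j = A j" using insert.hyps by auto
  have "?A ` I = A ` I" using eq by (rule image_cong[OF refl])
  then have "(\<Union>j\<in>insert i I. ?A j) = C \<union> (V - C)"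
    using A(1) by (simp only: UN_insert fun_upd_same)
  then have "(\<Union>j\<in>insert i I. ?A j) = V" using CV by blast
  moreover have "disjoint_family_on ?A (insert i I)"
    using A(1,2) insert.hyps eq by (subst disjoint_family_on_insert)
      (auto simp: disjoint_family_on_def)
  moreover have "\<forall>j\<in>insert i I. card (?A j) = m j \<and>
      (\<exists>B q. rooted E q B \<and> B \<subseteq> V \<and> card B \<le> 2 * m j - 1 \<and> ?A j \<subseteq> B)"
  proof
    fix j assume j: "j \<in> insert i I"
    show "card (?A j) = m j \<and>
      (\<exists>B q. rooted E q B \<and> B \<subseteq> V \<and> card B \<le> 2 * m j - 1 \<and> ?A j \<subseteq> B)"
    proof (cases "j = i")
      case True
      then show ?thesis using C by auto
    next
      case False
      then have "j \<in> I" using j by simp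
      then show ?thesis using A(3) eq by (metis Diff_subset subset_trans)
    qed
  qed
  ultimately show ?case by blast
qed

section \<open>Connected graphs as rooted sets\<close>

text \<open>A rooted set of maximum size with root \<open>r\<close> is closed under adjacency, as a
  neighbour outside could be added as a leaf. It therefore contains everything reachable from
  \<open>r\<close>.\<close>

lemma (in graph) connected_rooted:
  assumes "connected G"
  shows "\<exists>r. rooted (dominates G) r (verts G)"
proof -
  \<comment> \<open>\<open>connected\<close> speaks of the symmetric closure, which for a symmetric
    digraph has the same reachability.\<close>
  have reach: "u \<rightarrow>\<^sup>* v" if "u \<in> verts G" "v \<in> verts G" for u v
    using assms that reachable_mk_symmetric_eq[OF sym_arcs]
    by (auto simp: connected_def strongly_connected_def)
  obtain r where r: "r \<in> verts G"
    using assms by (auto simp: connected_def strongly_connected_def)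
  let ?P = "\<lambda>V. V \<subseteq> verts G \<and> rooted (dominates G) r V"
  have "?P {r}" using r by (auto intro: rooted.single)
  moreover have "\<forall>V. ?P V \<longrightarrow> card V < Suc (card (verts G))"
    by (auto intro: card_mono simp: less_Suc_eq_le)
  ultimately have "\<exists>V. ?P V \<and> (\<forall>W. ?P W \<longrightarrow> card W \<le> card V)"
    by (rule ex_has_greatest_nat)
  then obtain V where V: "?P V" and max: "\<And>W. ?P W \<Longrightarrow> card W \<le> card V"
    by (elim exE conjE) blast
  have "v \<in> V" if "v \<in> verts G" for v
  proof -
    have "r \<rightarrow>\<^sup>* v" using reach r that by blast
    then show ?thesis
    proof (induction rule: reachable_induct)
      case base
      then show ?case using V rooted_root by metis
    next
      case (step x y)
      show ?case
      proof (rule ccontr)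
        assume y: "y \<notin> V"
        have "?P (insert y V)"
          using V y step rooted_add_leaf[of "dominates G" r V x y] adj_in_verts by auto
        then have "card (insert y V) \<le> card V" by (rule max)
        then show False using y V rooted_finite[of _ r V] by auto
      qed
    qed
  qed
  then have "V = verts G" using V by blast
  then show ?thesis using V by blast
qed

section \<open>Growing subtrees by leaves\<close>

text \<open>A cycle through \<open>v\<close> must enter from \<open>u\<close> and return to
  \<open>u\<close> at once. With at least 3 arcs, \<open>u\<close> is then visited twice; only the
  2-cycle formed by opposite arcs escapes.\<close>

lemma (in pre_digraph) long_cycle_avoids_leaf:
  assumes "cycle p" "3 \<le> length p"
    and out: "\<And>e. e \<in> arcs G \<Longrightarrow> tail G e = v \<Longrightarrow> head G e = u"
    and "in": "\<And>e. e \<in> arcs G \<Longrightarrow> head G e = v \<Longrightarrow> tail G e = u"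
  shows "v \<notin> head G ` set p"
proof
  assume "v \<in> head G ` set p"
  then obtain e q r where e: "head G e = v" "p = q @ e # r"
    by (metis imageE split_list)
  obtain x where x: "awalk x p x" "distinct (tl (awalk_verts x p))" "p \<noteq> []"
    using assms(1) by (auto simp: cycle_def)
  have cas: "cas x p x" and arcs: "set p \<subseteq> arcs G" using x by (auto simp: awalk_def)
  have dist: "distinct (map (head G) p)"
    using x(2,3) awalk_verts_conv'[OF cas] by simp
  have te: "tail G e = u" using "in" e arcs by auto
  have last_head: "cas a w b \<Longrightarrow> w \<noteq> [] \<Longrightarrow> b \<in> head G ` set w" for a w b
    by (induction w arbitrary: a) (auto split: if_splits, metis cas.simps(1))
  have q: "cas x q u" and r: "cas v r x"
    using cas e te by (auto simp: awalk_verts_conv split: if_splits)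
  show False
  \<comment> \<open>Cyclically, the arc before \<open>e\<close> and the arc \<open>f\<close> after
    \<open>e\<close> both end in \<open>u\<close>, and they differ because of the length,
    contradicting \<open>dist\<close>. The cases are whether \<open>e\<close> is inner, first or
    last in the list \<open>p\<close>.\<close>
  proof (cases r)
    case (Cons f r')
    then have f: "head G f = u" "cas u r' x" using r out[of f] arcs e by auto
    show False
    proof (cases "q = []")
      case True
      then have "r' \<noteq> []" "x = u" using assms(2) e Cons q by auto
      then have "u \<in> head G ` set r'" using last_head f(2) by blast
      then show False using dist e Cons f by auto
    next
      case False
      then have "u \<in> head G ` set q" using last_head q by blast
      then show False using dist e Cons f by auto
    qed
  next
    case Nil
    then have "x = v" using r by simp
    moreover obtain f q' where q': "q = f # q'" using assms(2) e Nil by (cases q) auto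
    ultimately have f: "head G f = u" "cas u q' u" using q out[of f] arcs e by auto
    have "q' \<noteq> []" using assms(2) e Nil q' by auto
    then have "u \<in> head G ` set q'" using last_head f(2) by blast
    then show False using dist e q' f by auto
  qed
qed

lemma (in graph) subtree_single:
  assumes "v \<in> verts G"
  shows "subtree \<lparr>verts = {v}, arcs = {}, tail = tail G, head = head G\<rparr> G"
proof -
  let ?T = "\<lparr>verts = {v}, arcs = {}, tail = tail G, head = head G\<rparr>"
  have sub: "subgraph ?T G"
    using assms by (auto simp: subgraph_def compatible_def wf_digraph_def wf_digraph)
  interpret T: digraph ?T using sub by (rule digraph_subgraph)
  have "graph ?T" by (rule T.graphI) (simp add: symmetric_conv)
  moreover have "connected ?T"
    by (auto simp: connected_def strongly_connected_def reachable_def)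
  moreover have "\<not> T.cycle p" for p
    by (auto simp: T.cycle_def T.awalk_def)
  ultimately show ?thesis using sub by (auto simp: subtree_def undirected_tree_def)
qed

text \<open>Both opposite arcs \<open>a\<close> and \<open>b\<close> are added to keep symmetry. A
  long cycle of the enlarged graph avoids the leaf \<open>v\<close>, hence uses only arcs of
  \<open>T\<close>, where it is impossible.\<close>

lemma (in graph) subtree_add_leaf:
  assumes T: "subtree T G" and u: "u \<in> verts T" and uv: "u \<rightarrow> v" and v: "v \<notin> verts T"
  shows "\<exists>T'. subtree T' G \<and> verts T' = insert v (verts T)"
proof -
  have sub: "subgraph T G" and "graph T" and con: "connected T"
    and acyc: "\<not> (pre_digraph.cycle T p \<and> 3 \<le> length p)" for p
    using T by (auto simp: subtree_def undirected_tree_def)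
  interpret T: graph T by fact
  have TG: "tail T = tail G" "head T = head G" "verts T \<subseteq> verts G" "arcs T \<subseteq> arcs G"
    using sub by (auto simp: subgraph_def compatible_def)
  obtain a where a: "a \<in> arcs G" "tail G a = u" "head G a = v" using uv by blast
  obtain b where b: "b \<in> arcs G" "tail G b = v" "head G b = u"
    using graph_symmetric[OF uv] by blast
  define T' where
    "T' = \<lparr>verts = insert v (verts T), arcs = {a, b} \<union> arcs T, tail = tail G, head = head G\<rparr>"
  have T'_simps [simp]: "verts T' = insert v (verts T)" "arcs T' = {a, b} \<union> arcs T"
    "tail T' = tail G" "head T' = head G"
    by (simp_all add: T'_def)
  have vG: "v \<in> verts G" using a by auto
  have Tends: "tail G e \<in> verts T" "head G e \<in> verts T" if "e \<in> arcs T" for e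
    using that T.wellformed TG by metis+
  have sub': "subgraph T' G"
    using TG vG a b u Tends
    by (auto simp: subgraph_def compatible_def wf_digraph_def wf_digraph)
  interpret T': digraph T' using sub' by (rule digraph_subgraph)
  have "\<exists>e'\<in>arcs T. tail G e = head G e' \<and> head G e = tail G e'" if "e \<in> arcs T" for e
    using T.sym_arcs that TG by (auto simp: symmetric_conv)
  then have sym: "symmetric T'" using a b by (auto simp: symmetric_conv)
  have graph': "graph T'" by (rule T'.graphI) (rule sym)
  have subT: "subgraph T T'"
    using TG T.wf_digraph T'.wf_digraph by (auto simp: subgraph_def compatible_def)
  \<comment> \<open>The vertex \<open>u\<close> serves as a hub: it reaches every vertex, and
    symmetry supplies the way back.\<close>
  have "u \<rightarrow>\<^sup>*\<^bsub>T'\<^esub> w" if "w \<in> insert v (verts T)" for w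
  proof (cases "w = v")
    case True
    have "u \<rightarrow>\<^bsub>T'\<^esub> v" using a by (auto simp: arcs_ends_conv)
    then show ?thesis using True T'.reachable_adjI by blast
  next
    case False
    then have "u \<rightarrow>\<^sup>*\<^bsub>T\<^esub> w"
      using con that u T.reachable_mk_symmetric_eq[OF T.sym_arcs]
      by (auto simp: connected_def strongly_connected_def)
    then show ?thesis using subT by (rule T'.reachable_mono)
  qed
  then have "w \<rightarrow>\<^sup>*\<^bsub>T'\<^esub> w'" if "w \<in> insert v (verts T)" "w' \<in> insert v (verts T)" for w w'
    using that by (intro T'.reachable_trans[of w u w'] symmetric_reachable[OF sym, of u w])
  then have con': "connected T'"
    by (auto simp: connected_def strongly_connected_def T'.reachable_mk_symmetric_eq[OF sym])
  have False if p: "T'.cycle p" "3 \<le> length p" for p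
  proof -
    have "v \<notin> head T' ` set p"
      by (rule T'.long_cycle_avoids_leaf[OF p, of v u]) (use a b Tends v in auto)
    then have nv: "v \<notin> head G ` set p" by simp
    obtain x where x: "T'.awalk x p x" "distinct (tl (T'.awalk_verts x p))" "p \<noteq> []"
      using p by (auto simp: T'.cycle_def)
    have cas: "T'.cas x p x" and arcs: "set p \<subseteq> {a, b} \<union> arcs T"
      using x by (auto simp: T'.awalk_def)
    \<comment> \<open>In a closed walk the start \<open>x\<close> is the head of the last arc, so
      all vertices are heads of arcs. Thus \<open>v\<close> is not a tail either, which excludes
      \<open>a\<close> and \<open>b\<close>.\<close>
    have "set (T'.awalk_verts x p) = insert x (head G ` set p)"
      using T'.awalk_verts_conv'[OF cas] x(3) T'.cas_simp[OF x(3)] cas by auto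
    moreover have "x \<in> head G ` set p"
      using T'.awlast_if_cas[OF cas] x(3) by (auto simp: T'.awalk_verts_conv)
    ultimately have nv': "v \<notin> set (T'.awalk_verts x p)" using nv by auto
    have "set p \<subseteq> arcs T"
      proof
      fix e assume e: "e \<in> set p"
      then have "tail G e \<noteq> v" "head G e \<noteq> v"
        using nv nv' T'.awalk_verts_arc1[OF e, of x] by auto
      then show "e \<in> arcs T" using arcs e a b by auto
    qed
    moreover have "x \<in> verts T"
      using x(1) \<open>x \<in> head G ` set p\<close> nv by (auto simp: T'.awalk_def)
    moreover have comp: "compatible T' T" using TG by (simp add: compatible_def)
    ultimately have "T.awalk x p x"
      using cas compatible_cas[OF comp] by (auto simp: T.awalk_def)
    then have "T.cycle p" using x compatible_awalk_verts[OF comp] by (auto simp: T.cycle_def)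
    then show False using acyc p by blast
  qed
  then have "subtree T' G"
    using sub' graph' con' by (auto simp: subtree_def undirected_tree_def)
  then show ?thesis using T'_simps(1) by blast
qed

text \<open>A largest subtree inside \<open>B\<close> containing \<open>r\<close> must span
  \<open>B\<close>, since otherwise an edge leaving it within \<open>B\<close> yields a leaf to add.
  Growing by leaves avoids a separate acyclicity proof for two trees joined by an edge.\<close>

lemma (in graph) rooted_subtree:
  assumes "rooted (dominates G) r B" "B \<subseteq> verts G"
  shows "\<exists>T. subtree T G \<and> verts T = B"
proof -
  let ?P = "\<lambda>T. subtree T G \<and> r \<in> verts T \<and> verts T \<subseteq> B"
  have r: "r \<in> B" using assms rooted_root by metis
  have fin: "finite B" using assms rooted_finite by metis
  have "?P \<lparr>verts = {r}, arcs = {}, tail = tail G, head = head G\<rparr>"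
    using subtree_single[of r] r assms(2) by auto
  moreover have "\<forall>T. ?P T \<longrightarrow> card (verts T) < Suc (card B)"
    using fin by (auto intro: card_mono simp: less_Suc_eq_le)
  ultimately have "\<exists>T. ?P T \<and> (\<forall>T'. ?P T' \<longrightarrow> card (verts T') \<le> card (verts T))"
    by (rule ex_has_greatest_nat)
  then obtain T where T: "subtree T G" "r \<in> verts T" "verts T \<subseteq> B"
    and max: "\<And>T'. ?P T' \<Longrightarrow> card (verts T') \<le> card (verts T)"
    by (elim exE conjE) blast
  have "B \<subseteq> verts T"
  proof (rule ccontr)
    assume "\<not> B \<subseteq> verts T"
    then obtain u v where uv: "u \<in> verts T" "v \<in> B - verts T" "u \<rightarrow> v"
      using rooted_edge_leaving[OF assms(1) T(2)] by blast
    then obtain T' where T': "subtree T' G" "verts T' = insert v (verts T)"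
      using subtree_add_leaf[OF T(1) uv(1,3)] by blast
    then have "card (verts T') \<le> card (verts T)" using max[of T'] T uv by auto
    moreover have "finite (verts T)" using T fin finite_subset by blast
    ultimately show False using T' uv by simp
  qed
  then show ?thesis using T by blast
qed

theorem theorem2:
  fixes G :: "('a, 'b) pre_digraph" and n k :: nat and m :: "nat \<Rightarrow> nat"
  assumes "graph G" and "Digraph_Component.connected G" and "card (verts G) = n"
    and "n = (\<Sum>i=1..k. m i)" and "\<And>i. i \<in> {1..k} \<Longrightarrow> 0 < m i"
  shows "\<exists>A :: nat \<Rightarrow> 'a set.
    (\<Union>i\<in>{1..k}. A i) = verts G \<and> disjoint_family_on A {1..k} \<and>
    (\<forall>i\<in>{1..k}. card (A i) = m i \<and>
      (\<exists>T. subtree T G \<and> card (verts T) \<le> 2 * m i - 1 \<and> A i \<subseteq> verts T))"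
proof -
  interpret graph G by fact
  obtain r where "rooted (dominates G) r (verts G)"
    using connected_rooted assms(2) by blast
  then obtain A where A: "(\<Union>i\<in>{1..k}. A i) = verts G" "disjoint_family_on A {1..k}"
    "\<forall>i\<in>{1..k}. card (A i) = m i \<and>
      (\<exists>B q. rooted (dominates G) q B \<and> B \<subseteq> verts G \<and> card B \<le> 2 * m i - 1 \<and> A i \<subseteq> B)"
    using rooted_partition[of "{1..k}" m "verts G" "dominates G" r] assms by auto
  have "\<exists>T. subtree T G \<and> card (verts T) \<le> 2 * m i - 1 \<and> A i \<subseteq> verts T" if "i \<in> {1..k}" for i
    using A(3) that rooted_subtree by metis
  then show ?thesis using A by blast
qed

end
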